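(* Let $n\ge 0$. If $X\subseteq\{0,1\}^n$, then the daisy cube $Q_n(X)$ is a partial cube.
   Context: The $n$-cube $Q_n$ is the graph with vertex set $\{0,1\}^n$, two words being adjacent if they differ in exactly one coordinate ($Q_0=K_1$); hypercubes are the graphs $Q_m$, $m\ge 0$. For $u,v\in\{0,1\}^n$ write $u\le v$ if $u_i\le v_i$ for all $i$. For $X\subseteq\{0,1\}^n$, the daisy cube $Q_n(X)$ generated by $X$ is the subgraph of $Q_n$ induced by $\{u\in\{0,1\}^n : u\le x \text{ for some } x\in X\}$. A subgraph $H$ of a graph $G$ is isometric if $d_H(u,v)=d_G(u,v)$ for all $u,v\in V(H)$. Partial cubes are the (graphs isomorphic to) isometric subgraphs of hypercubes. *)

theory Defs
  imports "Graph_Theory.Graph_Theory"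
begin

text \<open>
  Undirected graphs are rendered as symmetric digraphs, an edge being a pair of opposite arcs.
  The words over \<open>{0,1}\<close> are lists of Booleans, with \<open>False\<close> for 0 and \<open>True\<close> for 1, so that
  the library order \<open>False \<le> True\<close> is the order of the two letters.
\<close>

definition words :: "nat \<Rightarrow> bool list set" where
  "words n = {u. length u = n}"

definition word_le :: "bool list \<Rightarrow> bool list \<Rightarrow> bool" where
  "word_le = list_all2 (\<le>)"

definition hypercube :: "nat \<Rightarrow> (bool list, bool list \<times> bool list) pre_digraph" where
  "hypercube n = with_proj
     \<lparr> pverts = words n,
       parcs = {(u, v). u \<in> words n \<and> v \<in> words n \<and> card {i. i < n \<and> u ! i \<noteq> v ! i} = 1} \<rparr>"

definition daisy_cube :: "nat \<Rightarrow> bool list set \<Rightarrow> (bool list, bool list \<times> bool list) pre_digraph" where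
  "daisy_cube n X = hypercube n \<restriction> {u \<in> words n. \<exists>x\<in>X. word_le u x}"

text \<open>
  The number of arcs on a shortest walk (unit weights); \<open>\<infinity>\<close> if there is no walk.
  Only meaningful for well-formed \<open>G\<close>.
\<close>
definition graph_dist :: "('a, 'b) pre_digraph \<Rightarrow> 'a \<Rightarrow> 'a \<Rightarrow> ereal" where
  "graph_dist G u v = wf_digraph.\<mu> G (\<lambda>_. 1) u v"

text \<open>
  The library relation \<open>subgraph\<close> is that of digraphs; \<open>symmetric H\<close> turns it into
  the subgraph relation of undirected graphs.
\<close>
definition isometric_subgraph :: "('a, 'b) pre_digraph \<Rightarrow> ('a, 'b) pre_digraph \<Rightarrow> bool" where
  "isometric_subgraph H G \<longleftrightarrow> subgraph H G \<and> symmetric H \<and>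
     (\<forall>u \<in> verts H. \<forall>v \<in> verts H. graph_dist H u v = graph_dist G u v)"

definition partial_cube :: "('a, 'b) pre_digraph \<Rightarrow> bool" where
  "partial_cube G \<longleftrightarrow> (\<exists>m H. isometric_subgraph H (hypercube m) \<and> digraph_iso G H)"

lemma graph_hypercube: "graph (hypercube n)"
proof -
  have fin: "finite (words n)"
    using finite_lists_length_eq[of "UNIV :: bool set" n] by (simp add: words_def)
  have sub: "{(u, v). u \<in> words n \<and> v \<in> words n \<and> card {i. i < n \<and> u ! i \<noteq> v ! i} = 1}
      \<subseteq> words n \<times> words n"
    by auto
  have "finite {(u, v). u \<in> words n \<and> v \<in> words n \<and> card {i. i < n \<and> u ! i \<noteq> v ! i} = 1}"
    by (rule finite_subset[OF sub]) (simp add: fin)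
  moreover have "{i. i < n \<and> u ! i \<noteq> v ! i} = {i. i < n \<and> v ! i \<noteq> u ! i}" for u v :: "bool list"
    by auto
  ultimately show ?thesis
    by unfold_locales
       (auto simp: hypercube_def fin symmetric_def sym_def arc_to_ends_def)
qed

end

theory Submission
  imports Defs
begin

text \<open>
  In a subgraph of the hypercube induced by a down-closed set of words, any two vertices \<open>u\<close>, \<open>v\<close>
  are joined by a walk of length their Hamming distance: first switch off, one at a time, the
  letters of \<open>u\<close> that are 1 in \<open>u\<close> and 0 in \<open>v\<close>, which stays below \<open>u\<close>; the resulting word lies
  below \<open>v\<close>, and switching on the remaining letters stays below \<open>v\<close>. The whole hypercube is the
  special case in which all words are kept, so both graph distances are the Hamming distance.
\<close>

definition hamming :: "bool list \<Rightarrow> bool list \<Rightarrow> nat" where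
  "hamming u v = card {i. i < length u \<and> u ! i \<noteq> v ! i}"

lemma hamming_0_iff:
  assumes "length u = length v"
  shows "hamming u v = 0 \<longleftrightarrow> u = v"
  using assms by (auto simp: hamming_def list_eq_iff_nth_eq)

lemma hamming_triangle:
  assumes "length u = length v"
  shows "hamming u w \<le> hamming u v + hamming v w"
proof -
  have "{i. i < length u \<and> u ! i \<noteq> w ! i}
      \<subseteq> {i. i < length u \<and> u ! i \<noteq> v ! i} \<union> {i. i < length v \<and> v ! i \<noteq> w ! i}"
    using assms by auto
  then have "hamming u w
      \<le> card ({i. i < length u \<and> u ! i \<noteq> v ! i} \<union> {i. i < length v \<and> v ! i \<noteq> w ! i})"
    unfolding hamming_def by (intro card_mono) auto
  also have "\<dots> \<le> hamming u v + hamming v w"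
    unfolding hamming_def by (rule card_Un_le)
  finally show ?thesis .
qed

text \<open>The two equations make the update an arc of the hypercube that leads exactly one step
  closer to \<open>v\<close>.\<close>

lemma hamming_list_update:
  assumes "i < length u" "u ! i \<noteq> v ! i"
  shows "hamming u (u[i := v ! i]) = 1"
    and "hamming u v = Suc (hamming (u[i := v ! i]) v)"
proof -
  have "{j. j < length u \<and> u ! j \<noteq> u[i := v ! i] ! j} = {i}"
    using assms by (auto simp: nth_list_update)
  then show "hamming u (u[i := v ! i]) = 1"
    by (simp add: hamming_def)
  have "{j. j < length u \<and> u ! j \<noteq> v ! j}
      = insert i {j. j < length u \<and> u[i := v ! i] ! j \<noteq> v ! j}"
    using assms by (auto simp: nth_list_update)
  then show "hamming u v = Suc (hamming (u[i := v ! i]) v)"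
    using assms by (simp add: hamming_def)
qed

context wf_digraph
begin

lemma graph_dist_le_length: "awalk u p v \<Longrightarrow> graph_dist G u v \<le> length p"
  using min_cost_le_walk_cost[of u p v "\<lambda>_. 1"]
  by (simp add: graph_dist_def awalk_cost_def sum_list_triv)

text \<open>The distance is an infimum over walks, so a lower bound on every walk passes to it, even
  if there is no walk and the distance is infinite.\<close>

lemma graph_dist_geI:
  assumes "\<And>p. awalk u p v \<Longrightarrow> k \<le> length p"
  shows "k \<le> graph_dist G u v"
  unfolding graph_dist_def \<mu>_def
  by (rule INF_greatest) (use assms in \<open>auto simp: awalk_cost_def sum_list_triv\<close>)

end

lemma wf_hypercube: "wf_digraph (hypercube n)"
  using graph_hypercube[of n] by (simp add: graph_def digraph_def fin_digraph_def)

lemma verts_hypercube [simp]: "verts (hypercube n) = words n"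
  and tail_hypercube [simp]: "tail (hypercube n) = fst"
  and head_hypercube [simp]: "head (hypercube n) = snd"
  by (simp_all add: hypercube_def)

lemma arcs_hypercube:
  "arcs (hypercube n) = {(u, v). u \<in> words n \<and> v \<in> words n \<and> hamming u v = 1}"
  by (auto simp: hypercube_def hamming_def words_def)

lemma hypercube_restrict_words: "hypercube n \<restriction> words n = hypercube n"
  by (intro pre_digraph.equality) (auto simp: arcs_hypercube)

lemma word_le_trans: "word_le u v \<Longrightarrow> word_le v w \<Longrightarrow> word_le u w"
  unfolding word_le_def by (rule list_all2_trans[of "(\<le>)" "(\<le>)" "(\<le>)"]) auto

text \<open>Here \<open>u\<close> ranges over all lists, but \<open>word_le\<close> relates only
  lists of equal length, so these are the down-sets of the cube.\<close>

definition down_closed :: "nat \<Rightarrow> bool list set \<Rightarrow> bool" where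
  "down_closed n S \<longleftrightarrow> S \<subseteq> words n \<and> (\<forall>u v. word_le u v \<longrightarrow> v \<in> S \<longrightarrow> u \<in> S)"

lemma down_closed_step:
  assumes S: "down_closed n S" and uv: "u \<in> S" "v \<in> S" "u \<noteq> v"
  obtains i where "i < n" "u ! i \<noteq> v ! i" "u[i := v ! i] \<in> S"
proof -
  have len: "length u = n" "length v = n"
    using S uv by (auto simp: down_closed_def words_def)
  have down: "u' \<in> S" if "word_le u' w" "w \<in> S" for u' w
    using S that by (auto simp: down_closed_def)
  show thesis
  proof (cases "\<exists>i<n. u ! i \<and> \<not> v ! i")
    case True
    then obtain i where i: "i < n" "u ! i" "\<not> v ! i"
      by blast
    have "word_le (u[i := v ! i]) u"
      using i len by (auto simp: word_le_def list_all2_conv_all_nth nth_list_update)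
    then show thesis
      using that i uv down by blast
  next
    \<comment> \<open>Now \<open>u\<close> lies below \<open>v\<close>, so at a position where they
      differ a 0 of \<open>u\<close> is switched to the 1 of \<open>v\<close>.\<close>
    case False
    obtain i where i: "i < n" "u ! i \<noteq> v ! i"
      using len \<open>u \<noteq> v\<close> by (auto simp: list_eq_iff_nth_eq)
    have "word_le (u[i := v ! i]) v"
      using False i len
      by (auto simp: word_le_def list_all2_conv_all_nth nth_list_update split: if_splits)
    then show thesis
      using that i uv down by blast
  qed
qed

lemma graph_dist_down_closed:
  assumes S: "down_closed n S" and uv: "u \<in> S" "v \<in> S"
  shows "graph_dist (hypercube n \<restriction> S) u v = hamming u v"
proof -
  interpret H: wf_digraph "hypercube n \<restriction> S"
    using wf_hypercube by (rule wf_digraph.wellformed_induce_subgraph)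
  have words: "w \<in> words n" if "w \<in> S" for w
    using S that by (auto simp: down_closed_def)
  \<comment> \<open>Induction on the Hamming distance with the start \<open>u\<close> arbitrary,
    since each step replaces \<open>u\<close> by a closer word of \<open>S\<close>.\<close>
  have "\<exists>p. H.awalk u p v \<and> length p = hamming u v"
    using uv
  proof (induction "hamming u v" arbitrary: u)
    case 0
    then have "u = v"
      using words hamming_0_iff[of u v] by (simp add: words_def)
    then show ?case
      using 0 by (intro exI[of _ "[]"]) (simp add: H.awalk_Nil_iff)
  next
    case (Suc k)
    have "u \<noteq> v"
      using Suc.hyps(2) by (auto simp: hamming_def)
    then obtain i where i: "i < n" "u ! i \<noteq> v ! i" "u[i := v ! i] \<in> S"
      using down_closed_step[OF S] Suc.prems by metis
    let ?w = "u[i := v ! i]"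
    have "length u = n"
      using words Suc.prems by (simp add: words_def)
    then have ham: "hamming u ?w = 1" "hamming u v = Suc (hamming ?w v)"
      using i hamming_list_update[of i u v] by auto
    then obtain p where p: "H.awalk ?w p v" "length p = hamming ?w v"
      using Suc i by auto
    have "H.awalk u ((u, ?w) # p) v"
      using p ham i Suc.prems words by (auto simp: H.awalk_Cons_iff arcs_hypercube)
    then show ?case
      using p ham by (intro exI[of _ "(u, ?w) # p"]) simp
  qed
  then have upper: "graph_dist (hypercube n \<restriction> S) u v \<le> hamming u v"
    using H.graph_dist_le_length by metis
  \<comment> \<open>Each arc joins words at Hamming distance 1, so the triangle inequality along the
    walk gives the bound.\<close>
  have "hamming u v \<le> length p" if "H.awalk u p v" for p
    using that
  proof (induction p arbitrary: u)
    case Nil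
    then show ?case
      by (simp add: H.awalk_Nil_iff hamming_def)
  next
    case (Cons e p)
    then obtain w where e: "e = (u, w)" "u \<in> words n" "w \<in> words n" "hamming u w = 1"
      and "H.awalk w p v"
      by (cases e) (auto simp: H.awalk_Cons_iff arcs_hypercube)
    then have "hamming w v \<le> length p"
      using Cons.IH by blast
    then show ?case
      using hamming_triangle[of u w v] e by (simp add: words_def)
  qed
  then have "hamming u v \<le> graph_dist (hypercube n \<restriction> S) u v"
    by (rule H.graph_dist_geI)
  with upper show ?thesis
    by (rule order.antisym)
qed

lemma isometric_subgraph_down_closed:
  assumes S: "down_closed n S"
  shows "isometric_subgraph (hypercube n \<restriction> S) (hypercube n)"
proof -
  interpret Q: graph "hypercube n"
    by (rule graph_hypercube)
  have sub: "S \<subseteq> words n"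
    using S by (simp add: down_closed_def)
  \<comment> \<open>This lets the distance formula for down-sets also be applied to the whole
    hypercube.\<close>
  have "down_closed n (words n)"
    by (auto simp: down_closed_def words_def word_le_def dest: list_all2_lengthD)
  then have "graph_dist (hypercube n) u v = hamming u v" if "u \<in> S" "v \<in> S" for u v
    using graph_dist_down_closed[of n "words n" u v] sub that
    by (auto simp: hypercube_restrict_words)
  moreover have "induced_subgraph (hypercube n \<restriction> S) (hypercube n)"
    using sub by (intro Q.induced_induce) simp
  ultimately show ?thesis
    using graph_dist_down_closed[OF S] induced_graph_imp_symmetric[OF Q.sym_arcs]
    by (auto simp: isometric_subgraph_def)
qed

text \<open>The identity on vertices and arcs is the isomorphism; keeping \<open>head G\<close> and
  \<open>tail G\<close> preserves the incidences.\<close>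

lemma digraph_iso_refl:
  assumes "wf_digraph G"
  shows "digraph_iso G G"
  unfolding digraph_iso_def pre_digraph.digraph_isomorphism_def app_iso_def using assms
  by (intro exI[of _ "\<lparr>iso_verts = id, iso_arcs = id, iso_head = head G, iso_tail = tail G\<rparr>"]) simp

theorem proposition2p1:
  fixes n :: nat and X :: "bool list set"
  assumes "X \<subseteq> words n"
  shows "partial_cube (daisy_cube n X)"
proof -
  \<comment> \<open>By transitivity, a word below \<open>u\<close> is below the same generator
    \<open>x\<close>.\<close>
  have "down_closed n {u \<in> words n. \<exists>x\<in>X. word_le u x}"
    unfolding down_closed_def
    by (auto simp: words_def word_le_def dest: list_all2_lengthD
        intro: word_le_trans[unfolded word_le_def])
  then have "isometric_subgraph (daisy_cube n X) (hypercube n)"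
    unfolding daisy_cube_def by (rule isometric_subgraph_down_closed)
  \<comment> \<open>The daisy cube is itself the isometric subgraph sought, with
    \<open>m = n\<close>.\<close>
  moreover from this have "digraph_iso (daisy_cube n X) (daisy_cube n X)"
    by (intro digraph_iso_refl) (simp add: isometric_subgraph_def subgraph_def)
  ultimately show ?thesis
    unfolding partial_cube_def by blast
qed

end
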